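(* The price of anarchy, with respect to liquid welfare, of coarse correlated equilibria of simultaneous all-pay auctions with budgets where bidders have XOS valuations is at most $3$. That is, for every such instance $I$ and every coarse correlated equilibrium $A$ of $I$, $\mathrm{OPT}(I)\le3\,\mathrm{LW}(I,A)$.
   Context: Simultaneous all-pay auction: bidders $N=[n]$, $n\ge2$; items $M=[m]$, $m\ge1$. Bidder $i$ submits $a_i=(a_{ij})_{j\in M}\in\mathcal A_i=\mathbb R_{\ge0}^m$; $\mathcal A=\prod_i\mathcal A_i$. Each item $j$ is awarded to exactly one bidder among those with the highest bid on $j$, ties being resolved by a fixed order over bidders; $X_i(a)\subseteq M$ is the set of items won by $i$, and $i$ pays $P_i(a)=\sum_{j\in M}a_{ij}$ (whether winning or not). Bidder $i$ has a monotone valuation $v_i:2^M\to\mathbb R_{\ge0}$, $v_i(\emptyset)=0$, and a budget $B_i\in(0,\infty]$; $v_i$ is XOS (fractionally subadditive) if there is a class $\mathcal L_i$ of vectors $(v_{ij}^\ell)_{j\in M}\in\mathbb R_{\ge0}^m$ with $v_i(S)=\max_{\ell\in\mathcal L_i}\sum_{j\in S}v_{ij}^\ell$ for all $S\subseteq M$. Utility: $u_i(a)=v_i(X_i(a))-P_i(a)$. The feasible allocations $\mathcal X$ are the profiles $(x_i)_{i\in N}$ of pairwise disjoint subsets of $M$. $\Delta(S)$ denotes probability distributions on $S$. For $A\in\Delta(\mathcal A)$ let $A_{-i}$ be the marginal on the others' actions, and let $\mathcal C_i(A_{-i})$ be the set of $A_i'\in\Delta(\mathcal A_i)$ with $\mathbb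 E_{a_i'\sim A_i',a_{-i}\sim A_{-i}}[P_i(a_i',a_{-i})]\le B_i$ (independent draws). $A\in\Delta(\mathcal A)$ is a coarse correlated equilibrium if for all $i$: $\mathbb E_{a\sim A}[P_i(a)]\le B_i$, and $\mathbb E_{a\sim A}[u_i(a)]\ge\mathbb E_{a_i'\sim A_i',a_{-i}\sim A_{-i}}[u_i(a_i',a_{-i})]$ for all $A_i'\in\mathcal C_i(A_{-i})$. $\mathrm{LW}(I,A)=\sum_i\min\{\mathbb E_{a\sim A}[v_i(X_i(a))],B_i\}$ and $\mathrm{OPT}(I)=\max_{\chi\in\Delta(\mathcal X)}\sum_i\min\{\mathbb E_{x\sim\chi}[v_i(x_i)],B_i\}$. The price of anarchy is the supremum of $\mathrm{OPT}(I)/\mathrm{LW}(I,A)$ over instances $I$ and equilibria $A$. *)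

theory Defs
  imports "HOL-Probability.Probability"
begin

text \<open>
  Bidders and items are the initial segments \<open>{..<n}\<close> and \<open>{..<m}\<close> of the naturals. Budgets lie in
  \<^typ>\<open>ennreal\<close>, so \<open>\<infinity>\<close> is a legal budget. The pair \<open>(i, k) \<in> tie_order I\<close> means that bidder \<open>i\<close>
  is preferred to bidder \<open>k\<close> when both submit the highest bid on an item.
\<close>

record auction =
  num_bidders :: nat
  num_items :: nat
  valuation :: "nat \<Rightarrow> nat set \<Rightarrow> real"
  budget :: "nat \<Rightarrow> ennreal"
  tie_order :: "nat rel"

definition bidders :: "auction \<Rightarrow> nat set" where
  "bidders I = {..<num_bidders I}"

definition items :: "auction \<Rightarrow> nat set" where
  "items I = {..<num_items I}"

definition valuation_on :: "nat set \<Rightarrow> (nat set \<Rightarrow> real) \<Rightarrow> bool" where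
  "valuation_on M v \<longleftrightarrow>
     v {} = 0 \<and> (\<forall>S\<subseteq>M. 0 \<le> v S) \<and> (\<forall>S T. S \<subseteq> T \<and> T \<subseteq> M \<longrightarrow> v S \<le> v T)"

text \<open>The two conditions on each \<open>S\<close> say that \<open>v S\<close> is the (attained) maximum over the class \<open>L\<close>.\<close>

definition xos :: "nat set \<Rightarrow> (nat set \<Rightarrow> real) \<Rightarrow> bool" where
  "xos M v \<longleftrightarrow>
     (\<exists>L :: (nat \<Rightarrow> real) set.
        (\<forall>l\<in>L. \<forall>j\<in>M. 0 \<le> l j) \<and>
        (\<forall>S\<subseteq>M. (\<exists>l\<in>L. v S = (\<Sum>j\<in>S. l j)) \<and> (\<forall>l\<in>L. (\<Sum>j\<in>S. l j) \<le> v S)))"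

definition auction_instance :: "auction \<Rightarrow> bool" where
  "auction_instance I \<longleftrightarrow>
     2 \<le> num_bidders I \<and> 1 \<le> num_items I \<and>
     linear_order_on (bidders I) (tie_order I) \<and>
     (\<forall>i\<in>bidders I. valuation_on (items I) (valuation I i) \<and> 0 < budget I i)"

definition xos_instance :: "auction \<Rightarrow> bool" where
  "xos_instance I \<longleftrightarrow>
     auction_instance I \<and> (\<forall>i\<in>bidders I. xos (items I) (valuation I i))"


text \<open>
  Action sets carry their Borel structure: the underlying set of \<open>action_space I\<close> is
  \<open>items I \<rightarrow>\<^sub>E {0..}\<close>. An action profile \<open>a\<close> has \<open>a i j\<close> as the bid of bidder \<open>i\<close> on item \<open>j\<close>.
\<close>

definition action_space :: "auction \<Rightarrow> (nat \<Rightarrow> real) measure" where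
  "action_space I = (\<Pi>\<^sub>M j\<in>items I. restrict_space borel {0..})"

definition profile_space :: "auction \<Rightarrow> (nat \<Rightarrow> nat \<Rightarrow> real) measure" where
  "profile_space I = (\<Pi>\<^sub>M i\<in>bidders I. action_space I)"

definition others_space :: "auction \<Rightarrow> nat \<Rightarrow> (nat \<Rightarrow> nat \<Rightarrow> real) measure" where
  "others_space I i = (\<Pi>\<^sub>M k\<in>bidders I - {i}. action_space I)"

definition distributions :: "'a measure \<Rightarrow> 'a measure set" where
  "distributions S = {D. prob_space D \<and> sets D = sets S}"

definition won_items :: "auction \<Rightarrow> (nat \<Rightarrow> nat \<Rightarrow> real) \<Rightarrow> nat \<Rightarrow> nat set" where
  "won_items I a i =
     {j \<in> items I. \<forall>k\<in>bidders I. a k j < a i j \<or> (a k j = a i j \<and> (i, k) \<in> tie_order I)}"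

definition payment :: "auction \<Rightarrow> (nat \<Rightarrow> nat \<Rightarrow> real) \<Rightarrow> nat \<Rightarrow> real" where
  "payment I a i = (\<Sum>j\<in>items I. a i j)"

definition utility :: "auction \<Rightarrow> (nat \<Rightarrow> nat \<Rightarrow> real) \<Rightarrow> nat \<Rightarrow> real" where
  "utility I a i = valuation I i (won_items I a i) - payment I a i"


text \<open>
  Expected utilities may be \<open>-\<infinity>\<close>, since a bidder with infinite budget may have infinite expected
  payment. They are therefore taken as the integral of the positive part minus that of the
  negative part, in \<^typ>\<open>ereal\<close> (\<^const>\<open>ennreal\<close> sends negative reals to \<open>0\<close>). Utilities are bounded
  above, so the first integral is finite and the difference is well defined.
\<close>

definition ext_expectation :: "'a measure \<Rightarrow> ('a \<Rightarrow> real) \<Rightarrow> ereal" where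
  "ext_expectation D f =
     enn2ereal (\<integral>\<^sup>+ x. ennreal (f x) \<partial>D) - enn2ereal (\<integral>\<^sup>+ x. ennreal (- f x) \<partial>D)"

definition others_marginal ::
    "auction \<Rightarrow> nat \<Rightarrow> (nat \<Rightarrow> nat \<Rightarrow> real) measure \<Rightarrow> (nat \<Rightarrow> nat \<Rightarrow> real) measure" where
  "others_marginal I i A = distr A (others_space I i) (\<lambda>a. restrict a (bidders I - {i}))"

text \<open>
  Independent draws of \<open>x\<close> from \<open>D\<close> and \<open>b\<close> from \<open>A\<^sub>-\<^sub>i\<close> are draws from the product measure, and
  \<open>b(i := x)\<close> is the resulting action profile.
\<close>

definition feasible_deviations ::
    "auction \<Rightarrow> nat \<Rightarrow> (nat \<Rightarrow> nat \<Rightarrow> real) measure \<Rightarrow> (nat \<Rightarrow> real) measure set" where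
  "feasible_deviations I i Ao =
     {D \<in> distributions (action_space I).
        (\<integral>\<^sup>+ (x, b). ennreal (payment I (b(i := x)) i) \<partial>(D \<Otimes>\<^sub>M Ao)) \<le> budget I i}"

definition coarse_correlated_equilibrium ::
    "auction \<Rightarrow> (nat \<Rightarrow> nat \<Rightarrow> real) measure \<Rightarrow> bool" where
  "coarse_correlated_equilibrium I A \<longleftrightarrow>
     A \<in> distributions (profile_space I) \<and>
     (\<forall>i\<in>bidders I.
        (\<integral>\<^sup>+ a. ennreal (payment I a i) \<partial>A) \<le> budget I i \<and>
        (\<forall>D\<in>feasible_deviations I i (others_marginal I i A).
           ext_expectation (D \<Otimes>\<^sub>M others_marginal I i A) (\<lambda>(x, b). utility I (b(i := x)) i)
             \<le> ext_expectation A (\<lambda>a. utility I a i)))"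


definition liquid_welfare :: "auction \<Rightarrow> (nat \<Rightarrow> nat \<Rightarrow> real) measure \<Rightarrow> ennreal" where
  "liquid_welfare I A =
     (\<Sum>i\<in>bidders I. min (\<integral>\<^sup>+ a. ennreal (valuation I i (won_items I a i)) \<partial>A) (budget I i))"

definition feasible_allocations :: "auction \<Rightarrow> (nat \<Rightarrow> nat set) set" where
  "feasible_allocations I =
     {x \<in> bidders I \<rightarrow>\<^sub>E Pow (items I). disjoint_family_on x (bidders I)}"

text \<open>
  There are finitely many feasible allocations, so their distributions are exactly the probability
  mass functions supported on them, and the supremum is a maximum by compactness.
\<close>

definition optimal_liquid_welfare :: "auction \<Rightarrow> ennreal" where
  "optimal_liquid_welfare I =
     (SUP p \<in> {p. set_pmf p \<subseteq> feasible_allocations I}.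
        (\<Sum>i\<in>bidders I.
          min (\<integral>\<^sup>+ x. ennreal (valuation I i (x i)) \<partial>measure_pmf p) (budget I i)))"

text \<open>
  In \<^typ>\<open>ennreal\<close>, \<open>0 / 0 = 0\<close> and \<open>c / 0 = \<infinity>\<close> for \<open>c > 0\<close>; so an equilibrium of zero liquid welfare
  is disregarded only if the optimum vanishes as well.
\<close>

definition price_of_anarchy :: "(auction \<Rightarrow> bool) \<Rightarrow> ennreal" where
  "price_of_anarchy C =
     (SUP (I, A) \<in> {(I, A). C I \<and> coarse_correlated_equilibrium I A}.
        optimal_liquid_welfare I / liquid_welfare I A)"

end

theory Submission
  imports Defs
begin

text \<open>
  Let \<open>o\<^sub>i\<close> be the contribution of bidder \<open>i\<close> to the liquid welfare of a lottery \<open>p\<close> over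
  allocations, and scale the values of \<open>i\<close> by the factor \<open>c \<le> 1\<close> that makes their expectation
  under \<open>p\<close> equal to \<open>o\<^sub>i\<close>. Bidder \<open>i\<close> can deviate by drawing \<open>x\<close> from \<open>p\<close> and bidding, on each
  item of \<open>x i\<close>, uniformly between \<open>0\<close> and its scaled weight in the additive function supporting
  the valuation at \<open>x i\<close>. This costs \<open>o\<^sub>i / 2\<close> in expectation, which respects the budget, and yields
  a utility of at least \<open>o\<^sub>i / 2\<close> minus the expected highest bids on \<open>x i\<close>. Summing the equilibrium
  conditions over the bidders whose expected value is below their budget, the highest bids are
  covered by the total revenue, and the payments of the remaining bidders are at most their
  budgets. So the former bidders' share of the optimum is at most twice the liquid welfare, and
  the latter bidders' share is at most their own part of it.
\<close>

text \<open>The maximum includes the deviating bidder's own bid in \<open>a\<close>. This benchmark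
  is the same for every deviator, so the benchmarks of all deviations can be added up item by item
  and charged to the revenue.\<close>

definition top_bid :: "auction \<Rightarrow> (nat \<Rightarrow> nat \<Rightarrow> real) \<Rightarrow> nat \<Rightarrow> real" where
  "top_bid I a j = Max ((\<lambda>k. a k j) ` bidders I)"

section \<open>Measurability of bids, outcomes, payments and utilities\<close>

lemma finite_bidders [simp]: "finite (bidders I)"
  by (simp add: bidders_def)

lemma finite_items [simp]: "finite (items I)"
  by (simp add: items_def)

lemma won_items_subset: "won_items I a i \<subseteq> items I"
  by (auto simp: won_items_def)

lemma measurable_action_component:
  assumes "j \<in> items I"
  shows "(\<lambda>x. x j) \<in> borel_measurable (action_space I)"
proof -
  have "(\<lambda>x. x j) \<in> action_space I \<rightarrow>\<^sub>M restrict_space borel {0::real..}"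
    unfolding action_space_def by (rule measurable_component_singleton[OF assms])
  then show ?thesis
    by (simp add: measurable_restrict_space2_iff)
qed

lemma measurable_bid:
  assumes "i \<in> bidders I" "j \<in> items I"
  shows "(\<lambda>a. a i j) \<in> borel_measurable (profile_space I)"
proof -
  have "(\<lambda>a. a i) \<in> profile_space I \<rightarrow>\<^sub>M action_space I"
    unfolding profile_space_def by (rule measurable_component_singleton[OF assms(1)])
  from measurable_compose[OF this measurable_action_component[OF assms(2)]] show ?thesis .
qed

lemma action_space_nonneg: "x \<in> space (action_space I) \<Longrightarrow> j \<in> items I \<Longrightarrow> 0 \<le> x j"
  by (auto simp: action_space_def space_PiM PiE_def Pi_def space_restrict_space)

lemma bid_nonneg:
  "a \<in> space (profile_space I) \<Longrightarrow> i \<in> bidders I \<Longrightarrow> j \<in> items I \<Longrightarrow> 0 \<le> a i j"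
  by (rule action_space_nonneg[of "a i"]) (auto simp: profile_space_def space_PiM PiE_def Pi_def)

text \<open>Only finitely many sets can be won, so it is enough that each event of winning exactly
  \<open>S\<close> is measurable; it is a finite Boolean combination of comparisons between
  bids.\<close>

lemma measurable_won_items:
  assumes "i \<in> bidders I"
  shows "(\<lambda>a. won_items I a i) \<in> profile_space I \<rightarrow>\<^sub>M count_space UNIV"
proof -
  let ?M = "profile_space I"
  let ?w = "\<lambda>a j. \<forall>k\<in>bidders I. a k j < a i j \<or> (a k j = a i j \<and> (i, k) \<in> tie_order I)"
  have w: "Measurable.pred ?M (\<lambda>a. ?w a j)" if "j \<in> items I" for j
  proof (rule pred_intros_finite(3)[OF finite_bidders])
    fix k assume "k \<in> bidders I"
    have "Measurable.pred ?M (\<lambda>a. f a < g a \<or> (f a = g a \<and> b))"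
      if [measurable]: "f \<in> borel_measurable ?M" "g \<in> borel_measurable ?M"
      for f g :: "(nat \<Rightarrow> nat \<Rightarrow> real) \<Rightarrow> real" and b
    proof -
      have [measurable]: "Measurable.pred ?M (\<lambda>a. f a = g a)"
        unfolding pred_def by measurable
      show ?thesis by measurable
    qed
    from this[OF measurable_bid[OF \<open>k \<in> bidders I\<close> that] measurable_bid[OF assms that]]
    show "Measurable.pred ?M (\<lambda>a. a k j < a i j \<or> (a k j = a i j \<and> (i, k) \<in> tie_order I))" .
  qed
  have "Measurable.pred ?M (\<lambda>a. won_items I a i = S)" if "S \<subseteq> items I" for S
  proof -
    have "won_items I a i = S \<longleftrightarrow> (\<forall>j\<in>items I. ?w a j \<longleftrightarrow> j \<in> S)" for a
      using that by (auto simp: won_items_def)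
    moreover have "Measurable.pred ?M (\<lambda>a. \<forall>j\<in>items I. ?w a j \<longleftrightarrow> j \<in> S)"
    proof (rule pred_intros_finite(3)[OF finite_items])
      fix j assume "j \<in> items I"
      note [measurable] = w[OF this]
      show "Measurable.pred ?M (\<lambda>a. ?w a j \<longleftrightarrow> j \<in> S)" by measurable
    qed
    ultimately show ?thesis by simp
  qed
  then have "(\<lambda>a. won_items I a i) \<in> ?M \<rightarrow>\<^sub>M count_space (Pow (items I))"
    by (subst measurable_count_space_eq2)
      (auto simp: won_items_subset pred_def vimage_def Int_def conj_commute
        dest!: subsetD[OF won_items_subset])
  from measurable_compose[OF this, of "\<lambda>S. S" "count_space UNIV"] show ?thesis by simp
qed

lemma measurable_payment:
  "i \<in> bidders I \<Longrightarrow> (\<lambda>a. payment I a i) \<in> borel_measurable (profile_space I)"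
  unfolding payment_def by (intro borel_measurable_sum measurable_bid)

lemma measurable_won_value:
  "i \<in> bidders I \<Longrightarrow> (\<lambda>a. f (won_items I a i) :: real) \<in> borel_measurable (profile_space I)"
  by (rule measurable_compose[OF measurable_won_items]) auto

lemma measurable_utility:
  "i \<in> bidders I \<Longrightarrow> (\<lambda>a. utility I a i) \<in> borel_measurable (profile_space I)"
  unfolding utility_def by (intro borel_measurable_diff measurable_won_value measurable_payment)

lemma measurable_top_bid:
  "j \<in> items I \<Longrightarrow> (\<lambda>a. top_bid I a j) \<in> borel_measurable (profile_space I)"
  unfolding top_bid_def by (intro borel_measurable_Max measurable_bid) auto

lemma payment_nonneg:
  "a \<in> space (profile_space I) \<Longrightarrow> i \<in> bidders I \<Longrightarrow> 0 \<le> payment I a i"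
  unfolding payment_def by (intro sum_nonneg bid_nonneg)

section \<open>Unilateral deviations and extended expectations\<close>

lemma measurable_deviation:
  assumes "i \<in> bidders I" and [measurable]: "g \<in> S \<rightarrow>\<^sub>M action_space I"
  shows "(\<lambda>(s, a). a(i := g s)) \<in> S \<Otimes>\<^sub>M profile_space I \<rightarrow>\<^sub>M profile_space I"
  unfolding profile_space_def split_beta
  by (rule measurable_fun_upd[where J = "bidders I"])
    (use assms in \<open>auto simp: profile_space_def[symmetric]\<close>)

lemma measurable_deviation':
  assumes "i \<in> bidders I"
  shows "(\<lambda>(x, b). b(i := x)) \<in> action_space I \<Otimes>\<^sub>M others_space I i \<rightarrow>\<^sub>M profile_space I"
  unfolding profile_space_def others_space_def split_beta
  by (rule measurable_fun_upd[where J = "bidders I - {i}"])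
    (use assms in \<open>auto\<close>)

text \<open>The product of the law of \<open>g\<close> and the law of the others' bids is the image
  of the product of \<open>S\<close> and \<open>A\<close>. Deviations can thus be analysed with
  their own randomness \<open>S\<close> and with full profiles from \<open>A\<close>, whose
  coordinate \<open>i\<close> is overwritten anyway.\<close>

lemma nn_integral_deviation:
  assumes i: "i \<in> bidders I" and S: "prob_space S" and A: "A \<in> distributions (profile_space I)"
    and g: "g \<in> S \<rightarrow>\<^sub>M action_space I"
    and F: "F \<in> borel_measurable (profile_space I)"
  shows "(\<integral>\<^sup>+ (x, b). F (b(i := x)) \<partial>(distr S (action_space I) g \<Otimes>\<^sub>M others_marginal I i A))
       = (\<integral>\<^sup>+ (s, a). F (a(i := g s)) \<partial>(S \<Otimes>\<^sub>M A))"
proof -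
  let ?r = "\<lambda>a. restrict a (bidders I - {i})"
  interpret A: prob_space A using A by (simp add: distributions_def)
  have sA [measurable_cong]: "sets A = sets (profile_space I)"
    using A by (simp add: distributions_def)
  have r: "?r \<in> A \<rightarrow>\<^sub>M others_space I i"
    unfolding others_space_def
    by (subst measurable_cong_sets[OF sA refl], unfold profile_space_def)
      (rule measurable_restrict_subset, auto)
  interpret O: prob_space "distr A (others_space I i) ?r"
    by (rule A.prob_space_distr[OF r])
  have eq: "distr S (action_space I) g \<Otimes>\<^sub>M others_marginal I i A
      = distr (S \<Otimes>\<^sub>M A) (action_space I \<Otimes>\<^sub>M others_space I i) (\<lambda>(s, a). (g s, ?r a))"
    unfolding others_marginal_def
    by (rule pair_measure_distr[OF g r]) unfold_locales
  have m: "(\<lambda>(s, a). (g s, ?r a)) \<in> S \<Otimes>\<^sub>M A \<rightarrow>\<^sub>M action_space I \<Otimes>\<^sub>M others_space I i"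
    using g r by measurable
  have F': "(\<lambda>(x, b). F (b(i := x))) \<in> borel_measurable (action_space I \<Otimes>\<^sub>M others_space I i)"
    using measurable_compose[OF measurable_deviation'[OF i] F] by (simp add: split_beta')
  \<comment> \<open>Coordinate \<open>i\<close>, lost in the restriction, is overwritten; outside
    the bidders, profiles are already \<open>undefined\<close> by extensionality.\<close>
  have upd: "(?r a)(i := x) = a(i := x)" if "a \<in> space (profile_space I)" for a x
    using that by (auto simp: profile_space_def space_PiM PiE_def extensional_def fun_eq_iff)
  show ?thesis
    unfolding eq
    using F'
    by (subst nn_integral_distr[OF m])
      (auto intro!: nn_integral_cong simp: space_pair_measure upd sets_eq_imp_space_eq[OF sA]
        simp del: restrict_upd)
qed

lemma ext_expectation_integrable:
  assumes "integrable M f"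
  shows "ext_expectation M f = ereal (\<integral>x. f x \<partial>M)"
proof -
  have "(\<integral>\<^sup>+ x. ennreal (f x) \<partial>M) < \<infinity>" "(\<integral>\<^sup>+ x. ennreal (- f x) \<partial>M) < \<infinity>"
    using assms by (auto simp: real_integrable_def top.not_eq_extremum)
  then show ?thesis
    unfolding ext_expectation_def real_lebesgue_integral_def[OF assms]
    by (cases "\<integral>\<^sup>+ x. ennreal (f x) \<partial>M"; cases "\<integral>\<^sup>+ x. ennreal (- f x) \<partial>M") auto
qed

section \<open>Uniform bids against a fixed competing bid\<close>

lemma prob_space_unit_interval: "prob_space (restrict_space lborel {0..1::real})"
  by (rule prob_spaceI) (simp add: space_restrict_space emeasure_restrict_space)

lemma measure_unit_interval_greaterThan:
  fixes c :: real
  assumes "0 \<le> c" "c \<le> 1"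
  shows "measure (restrict_space lborel {0..1}) {t \<in> {0..1}. c < t} = 1 - c"
proof -
  have "{t \<in> {0..1}. c < t} = {c<..1}" using assms by auto
  moreover have "measure (restrict_space lborel {0..1}) {c<..1} = measure lborel {c<..1}"
    using assms by (intro measure_restrict_space) auto
  ultimately show ?thesis using assms by simp
qed

lemma integral_unit_interval_id: "(\<integral>t. t \<partial>restrict_space lborel {0..1::real}) = 1 / 2"
proof -
  have "(\<integral>t. t \<partial>restrict_space lborel {0..1::real})
      = (\<integral>t. indicator {0..1} t * t \<partial>lborel)"
    by (subst integral_restrict_space) auto
  also have "\<dots> = 1 / 2"
    using integral_power[of 0 1 1] by (simp add: mult.commute)
  finally show ?thesis .
qed

text \<open>
  Bidding uniformly on \<open>[0, c * l]\<close> against a competing bid \<open>y\<close> gains at least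
  \<open>l * (1 - y / (c * l))\<close>, which dominates the right-hand side as \<open>c \<le> 1\<close>.
\<close>

lemma uniform_bid_win:
  fixes c l y :: real
  assumes "0 \<le> c" "c \<le> 1" "0 \<le> l" "0 \<le> y"
  shows "c * l - y \<le>
    (\<integral>t. l * indicator {t. y < t * (c * l)} t \<partial>restrict_space lborel {0..1})"
proof (cases "c * l \<le> y")
  case True
  have "0 \<le> (\<integral>t. l * indicator {t. y < t * (c * l)} t \<partial>restrict_space lborel {0..1})"
    using assms by (intro integral_nonneg_AE) auto
  with True show ?thesis by linarith
next
  case False
  then have pos: "0 < c * l" and d: "y / (c * l) < 1"
    using assms by (auto simp: field_simps)
  \<comment> \<open>The bid \<open>t * (c * l)\<close> beats \<open>y\<close> exactly when
    \<open>t\<close> exceeds \<open>y / (c * l)\<close>, so the integral is \<open>l\<close> times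
    the length of an interval.\<close>
  have "(\<integral>t. l * indicator {t. y < t * (c * l)} t \<partial>restrict_space lborel {0..1})
      = l * (\<integral>t. indicator {t \<in> {0..1}. y / (c * l) < t} t \<partial>restrict_space lborel {0..1})"
    using pos
    by (subst integral_mult_right_zero[symmetric])
      (auto intro!: Bochner_Integration.integral_cong
        simp: space_restrict_space indicator_def field_simps)
  also have "\<dots> = l * (1 - y / (c * l))"
  proof -
    have "{t \<in> {0..1}. y / (c * l) < t} \<inter> space (restrict_space lborel {0..1::real})
        = {t \<in> {0..1}. y / (c * l) < t}"
      by (auto simp: space_restrict_space)
    then show ?thesis
      using measure_unit_interval_greaterThan[of "y / (c * l)"] pos d assms by simp
  qed
  finally have "(\<integral>t. l * indicator {t. y < t * (c * l)} t \<partial>restrict_space lborel {0..1})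
      = l * (1 - y / (c * l))" .
  moreover have "c * (l * (1 - y / (c * l))) \<le> l * (1 - y / (c * l))"
    using d assms by (intro mult_left_le_one_le mult_nonneg_nonneg) auto
  moreover have "c * (l * (1 - y / (c * l))) = c * l - y"
    using pos by (auto simp: field_simps)
  ultimately show ?thesis by linarith
qed

section \<open>Equilibrium conditions of a single bidder\<close>

locale xos_equilibrium =
  fixes I :: auction and A :: "(nat \<Rightarrow> nat \<Rightarrow> real) measure"
  assumes inst: "xos_instance I" and equil: "coarse_correlated_equilibrium I A"
begin

abbreviation "M \<equiv> items I"
abbreviation "v \<equiv> valuation I"

lemma dist_A: "A \<in> distributions (profile_space I)"
  using equil by (simp add: coarse_correlated_equilibrium_def)

sublocale prob_space A
  using dist_A by (simp add: distributions_def)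

lemma sets_A [measurable_cong]: "sets A = sets (profile_space I)"
  using dist_A by (simp add: distributions_def)

lemma space_A: "space A = space (profile_space I)"
  by (rule sets_eq_imp_space_eq[OF sets_A])

lemma measurable_A: "f \<in> profile_space I \<rightarrow>\<^sub>M N \<Longrightarrow> f \<in> A \<rightarrow>\<^sub>M N"
  by (subst measurable_cong_sets[OF sets_A refl])

context
  fixes i assumes i: "i \<in> bidders I"
begin

lemma val_nonneg: "S \<subseteq> M \<Longrightarrow> 0 \<le> v i S"
  and val_mono: "S \<subseteq> T \<Longrightarrow> T \<subseteq> M \<Longrightarrow> v i S \<le> v i T"
  using inst i by (auto simp: xos_instance_def auction_instance_def valuation_on_def)

lemma won_value_bounds: "0 \<le> v i (won_items I a i)" "v i (won_items I a i) \<le> v i M"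
  using val_nonneg val_mono won_items_subset by auto

lemma integrable_won_value: "integrable A (\<lambda>a. v i (won_items I a i))"
  by (rule integrable_const_bound[where B = "v i M"])
    (use won_value_bounds in \<open>auto intro: measurable_A measurable_won_value i\<close>)

text \<open>The payment depends on the bidder's own bids only, so the budget condition reduces to an
  integral over \<open>S\<close>. The right-hand side stays extended because the lemma is applied to
  the zero bid before expected payments are known to be finite.\<close>

lemma deviation_bound:
  assumes S: "prob_space S" and g: "g \<in> S \<rightarrow>\<^sub>M action_space I"
    and budget: "(\<integral>\<^sup>+ s. ennreal (\<Sum>j\<in>M. g s j) \<partial>S) \<le> budget I i"
    and int: "integrable (S \<Otimes>\<^sub>M A) (\<lambda>(s, a). utility I (a(i := g s)) i)"
  shows "ereal (\<integral>(s, a). utility I (a(i := g s)) i \<partial>(S \<Otimes>\<^sub>M A))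
    \<le> ext_expectation A (\<lambda>a. utility I a i)"
proof -
  interpret S: prob_space S by (rule S)
  let ?D = "distr S (action_space I) g"
  have u: "(\<lambda>a. ennreal (utility I a i)) \<in> borel_measurable (profile_space I)"
    "(\<lambda>a. ennreal (- utility I a i)) \<in> borel_measurable (profile_space I)"
    using measurable_utility[OF i] by measurable
  have p: "(\<lambda>a. ennreal (payment I a i)) \<in> borel_measurable (profile_space I)"
    using measurable_payment[OF i] by measurable
  have g': "(\<lambda>s. ennreal (\<Sum>j\<in>M. g s j)) \<in> borel_measurable S"
    using measurable_compose[OF g measurable_action_component] by measurable
  have "(\<integral>\<^sup>+ (x, b). ennreal (payment I (b(i := x)) i) \<partial>(?D \<Otimes>\<^sub>M others_marginal I i A))
      = (\<integral>\<^sup>+ (s, a). ennreal (\<Sum>j\<in>M. g s j) \<partial>(S \<Otimes>\<^sub>M A))"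
    by (subst nn_integral_deviation[OF i S dist_A g p]) (simp add: payment_def)
  also have "\<dots> = (\<integral>\<^sup>+ s. ennreal (\<Sum>j\<in>M. g s j) \<partial>S)"
    using g' by (subst nn_integral_fst[symmetric]) (auto simp: emeasure_space_1)
  finally have "?D \<in> feasible_deviations I i (others_marginal I i A)"
    using budget S.prob_space_distr[OF g]
    by (simp add: feasible_deviations_def distributions_def)
  then have "ext_expectation (?D \<Otimes>\<^sub>M others_marginal I i A) (\<lambda>(x, b). utility I (b(i := x)) i)
      \<le> ext_expectation A (\<lambda>a. utility I a i)"
    using equil i by (simp add: coarse_correlated_equilibrium_def)
  also have "ext_expectation (?D \<Otimes>\<^sub>M others_marginal I i A) (\<lambda>(x, b). utility I (b(i := x)) i)
      = ext_expectation (S \<Otimes>\<^sub>M A) (\<lambda>(s, a). utility I (a(i := g s)) i)"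
    using nn_integral_deviation[OF i S dist_A g u(1)] nn_integral_deviation[OF i S dist_A g u(2)]
    by (simp add: ext_expectation_def split_beta')
  finally show ?thesis
    by (simp add: ext_expectation_integrable[OF int])
qed

text \<open>The value won lies between 0 and \<open>v i M\<close> and the payment between 0 and
  \<open>C\<close>, so the utility is bounded whatever the others bid.\<close>

lemma integrable_deviation_utility:
  assumes S: "prob_space S" and g: "g \<in> S \<rightarrow>\<^sub>M action_space I"
    and C: "\<And>s. s \<in> space S \<Longrightarrow> (\<Sum>j\<in>M. g s j) \<le> C"
  shows "integrable (S \<Otimes>\<^sub>M A) (\<lambda>(s, a). utility I (a(i := g s)) i)"
proof -
  interpret S: prob_space S by (rule S)
  interpret P: pair_prob_space S A ..
  have "0 \<le> (\<Sum>j\<in>M. g s j)" if "s \<in> space S" for s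
    using measurable_space[OF g that] by (intro sum_nonneg action_space_nonneg)
  then have "\<bar>utility I (a(i := g s)) i\<bar> \<le> v i M + C" if "s \<in> space S" for s a
    using C[OF that] that won_value_bounds[of "a(i := g s)"]
    by (smt (verit) fun_upd_same payment_def utility_def)
  then have "AE z in S \<Otimes>\<^sub>M A. norm (case z of (s, a) \<Rightarrow> utility I (a(i := g s)) i) \<le> v i M + C"
    by (intro AE_I2) (auto simp: space_pair_measure)
  moreover have "(\<lambda>(s, a). utility I (a(i := g s)) i) \<in> borel_measurable (S \<Otimes>\<^sub>M A)"
  proof -
    have "(\<lambda>(s, a). a(i := g s)) \<in> S \<Otimes>\<^sub>M A \<rightarrow>\<^sub>M profile_space I"
      by (subst measurable_cong_sets[OF sets_pair_measure_cong[OF refl sets_A] refl])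
        (rule measurable_deviation[OF i g])
    from measurable_compose[OF this measurable_utility[OF i]] show ?thesis
      by (simp add: split_beta')
  qed
  ultimately show ?thesis
    by (rule P.integrable_const_bound)
qed

text \<open>
  The zero bid guarantees a nonnegative utility, so the equilibrium utility is not \<open>-\<infinity>\<close> and the
  expected payment is finite even when the budget is not.
\<close>

lemma integrable_payment: "integrable A (\<lambda>a. payment I a i)"
proof -
  \<comment> \<open>A one-point space encodes the deterministic deviation.\<close>
  let ?S = "measure_pmf (return_pmf ())"
  let ?g = "\<lambda>_ :: unit. \<lambda>j\<in>M. 0 :: real"
  let ?u = "\<lambda>a. utility I a i"
  have S: "prob_space ?S" by unfold_locales
  have g: "?g \<in> ?S \<rightarrow>\<^sub>M action_space I"
    by (auto simp: action_space_def space_PiM space_restrict_space)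
  have int: "integrable (?S \<Otimes>\<^sub>M A) (\<lambda>(s, a). utility I (a(i := ?g s)) i)"
    by (rule integrable_deviation_utility[OF S g, of 0]) simp
  have "0 \<le> (\<integral>(s, a). utility I (a(i := ?g s)) i \<partial>(?S \<Otimes>\<^sub>M A))"
    by (intro integral_nonneg_AE AE_I2)
      (auto simp: utility_def payment_def won_value_bounds)
  also have "ereal \<dots> \<le> ext_expectation A ?u"
    by (rule deviation_bound[OF S g _ int]) simp
  finally have ext: "0 \<le> ext_expectation A ?u"
    by (simp add: zero_ereal_def)
  have "?u a \<le> v i M" if "a \<in> space A" for a
    using won_value_bounds(2)[of a] payment_nonneg[OF that[unfolded space_A] i]
    by (simp add: utility_def)
  then have "(\<integral>\<^sup>+ a. ennreal (?u a) \<partial>A) \<le> (\<integral>\<^sup>+ a. ennreal (v i M) \<partial>A)"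
    by (intro nn_integral_mono ennreal_leI)
  also have "\<dots> < \<infinity>" by (simp add: emeasure_space_1)
  \<comment> \<open>With a finite positive part, an infinite negative part would make the difference
    \<open>-\<infinity>\<close>, against \<open>ext\<close>.\<close>
  finally have neg: "(\<integral>\<^sup>+ a. ennreal (- ?u a) \<partial>A) < \<infinity>"
    using ext unfolding ext_expectation_def
    by (cases "\<integral>\<^sup>+ a. ennreal (?u a) \<partial>A"; cases "\<integral>\<^sup>+ a. ennreal (- ?u a) \<partial>A") auto
  have [measurable]: "?u \<in> borel_measurable A"
    by (intro measurable_A measurable_utility i)
  \<comment> \<open>The payment is value minus utility and the value is bounded, so only the
    negative part of the utility can make it large.\<close>
  have "ennreal (payment I a i) \<le> ennreal (v i M) + ennreal (- ?u a)" for a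
  proof -
    have "payment I a i \<le> v i M + max 0 (- ?u a)"
      using won_value_bounds[of a] by (simp add: utility_def)
    then have "ennreal (payment I a i) \<le> ennreal (v i M + max 0 (- ?u a))"
      by (rule ennreal_leI)
    also have "\<dots> = ennreal (v i M) + ennreal (max 0 (- ?u a))"
      by (rule ennreal_plus) (auto intro: val_nonneg)
    finally show ?thesis by (simp add: max_def ennreal_neg split: if_splits)
  qed
  then have "(\<integral>\<^sup>+ a. ennreal (payment I a i) \<partial>A)
      \<le> (\<integral>\<^sup>+ a. ennreal (v i M) + ennreal (- ?u a) \<partial>A)"
    by (intro nn_integral_mono) auto
  also have "\<dots> = ennreal (v i M) + (\<integral>\<^sup>+ a. ennreal (- ?u a) \<partial>A)"
    by (subst nn_integral_add) (auto simp: emeasure_space_1)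
  also have "\<dots> < \<infinity>" using neg by simp
  finally show ?thesis
    using payment_nonneg[OF _ i]
    by (intro integrableI_nonneg measurable_A measurable_payment i) (auto simp: space_A)
qed

text \<open>One supporting additive function is chosen for each set. Choosing from the class even
  for sets that are not subsets of \<open>M\<close> makes the first two properties unconditional in
  \<open>S\<close>.\<close>

lemma xos_supports:
  obtains l :: "nat set \<Rightarrow> nat \<Rightarrow> real" where
    "\<And>S j. j \<in> M \<Longrightarrow> 0 \<le> l S j"
    "\<And>S T. T \<subseteq> M \<Longrightarrow> (\<Sum>j\<in>T. l S j) \<le> v i T"
    "\<And>S. S \<subseteq> M \<Longrightarrow> v i S = (\<Sum>j\<in>S. l S j)"
proof -
  obtain L where L: "\<And>l j. l \<in> L \<Longrightarrow> j \<in> M \<Longrightarrow> 0 \<le> l j"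
    "\<And>S. S \<subseteq> M \<Longrightarrow> \<exists>l\<in>L. v i S = (\<Sum>j\<in>S. l j)"
    "\<And>S l. S \<subseteq> M \<Longrightarrow> l \<in> L \<Longrightarrow> (\<Sum>j\<in>S. l j) \<le> v i S"
    using inst i unfolding xos_instance_def xos_def by metis
  have "\<forall>S. \<exists>l\<in>L. S \<subseteq> M \<longrightarrow> v i S = (\<Sum>j\<in>S. l j)"
    using L(2) by blast
  then obtain l where "\<And>S. l S \<in> L" "\<And>S. S \<subseteq> M \<longrightarrow> v i S = (\<Sum>j\<in>S. l S j)"
    by metis
  with L(1,3) show ?thesis
    by (intro that[of l]) simp_all
qed

end

section \<open>Highest bids and revenue\<close>

lemma top_bid_ge: "k \<in> bidders I \<Longrightarrow> a k j \<le> top_bid I a j"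
  unfolding top_bid_def by (intro Max_ge) auto

lemma bidders_nonempty: "bidders I \<noteq> {}"
  using inst by (auto simp: xos_instance_def auction_instance_def bidders_def lessThan_empty_iff)

lemma top_bid_nonneg: "a \<in> space A \<Longrightarrow> j \<in> M \<Longrightarrow> 0 \<le> top_bid I a j"
  using bidders_nonempty bid_nonneg top_bid_ge order_trans unfolding space_A
  by (metis ex_in_conv)

text \<open>A maximum of nonnegative bids is at most their sum, and every bid is paid, won or lost;
  exchanging the sums gives the revenue.\<close>

lemma sum_top_bid_le:
  assumes "a \<in> space A"
  shows "(\<Sum>j\<in>M. top_bid I a j) \<le> (\<Sum>i\<in>bidders I. payment I a i)"
proof -
  have "top_bid I a j \<le> (\<Sum>i\<in>bidders I. a i j)" if "j \<in> M" for j
    unfolding top_bid_def using bidders_nonempty assms that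
    by (auto intro!: Max.boundedI member_le_sum[where f = "\<lambda>k. a k j"] bid_nonneg simp: space_A)
  then show ?thesis
    unfolding payment_def by (subst sum.swap) (rule sum_mono)
qed

text \<open>Highest bids are dominated by the revenue, whose integrability rests on the zero-bid
  argument.\<close>

lemma integrable_top_bid:
  assumes "j \<in> M"
  shows "integrable A (\<lambda>a. top_bid I a j)"
proof (rule Bochner_Integration.integrable_bound)
  show "integrable A (\<lambda>a. \<Sum>i\<in>bidders I. payment I a i)"
    by (intro Bochner_Integration.integrable_sum integrable_payment)
  show "(\<lambda>a. top_bid I a j) \<in> borel_measurable A"
    by (intro measurable_A measurable_top_bid assms)
  show "AE a in A. norm (top_bid I a j) \<le> norm (\<Sum>i\<in>bidders I. payment I a i)"
  proof (rule AE_I2)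
    fix a assume a: "a \<in> space A"
    have "top_bid I a j \<le> (\<Sum>j\<in>M. top_bid I a j)"
      by (rule member_le_sum) (use a assms top_bid_nonneg in auto)
    also note sum_top_bid_le[OF a]
    finally show "norm (top_bid I a j) \<le> norm (\<Sum>i\<in>bidders I. payment I a i)"
      using top_bid_nonneg[OF a assms] by simp
  qed
qed

section \<open>Deviating to uniform bids\<close>

lemma tie_refl: "i \<in> bidders I \<Longrightarrow> (i, i) \<in> tie_order I"
  using inst
  unfolding xos_instance_def auction_instance_def linear_order_on_def partial_order_on_def
    preorder_on_def
  by (blast dest: refl_onD)

text \<open>
  The single random factor \<open>t\<close> correlates the bids on different items; only their marginals matter.
\<close>

lemma uniform_deviation_utility:
  fixes c :: real
  assumes i: "i \<in> bidders I" and S: "S \<subseteq> M" and a: "a \<in> space A"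
    and l: "\<And>j. j \<in> M \<Longrightarrow> 0 \<le> l j" "\<And>T. T \<subseteq> M \<Longrightarrow> (\<Sum>j\<in>T. l j) \<le> v i T"
      "v i S = (\<Sum>j\<in>S. l j)"
    and c: "0 \<le> c" "c \<le> 1"
    and g: "g = (\<lambda>t. \<lambda>j\<in>M. t * (if j \<in> S then c * l j else 0))"
    and int: "integrable (restrict_space lborel {0..1}) (\<lambda>t. utility I (a(i := g t)) i)"
  shows "c * v i S / 2 - (\<Sum>j\<in>S. top_bid I a j)
    \<le> (\<integral>t. utility I (a(i := g t)) i \<partial>restrict_space lborel {0..1})"
proof -
  let ?U = "restrict_space lborel {0..1::real}"
  interpret U: prob_space ?U by (rule prob_space_unit_interval)
  have fS: "finite S" by (rule finite_subset[OF S finite_items])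
  let ?win = "\<lambda>j t. l j * indicator {t. top_bid I a j < t * (c * l j)} t :: real"
  have low: "(\<Sum>j\<in>S. ?win j t) - t * (c * v i S) \<le> utility I (a(i := g t)) i"
    if "t \<in> space ?U" for t
  proof -
    let ?W = "{j \<in> S. top_bid I a j < t * (c * l j)}"
    \<comment> \<open>Exceeding \<open>top_bid\<close> means beating all other bidders strictly, so
      ties with them do not arise; \<open>won_items\<close> also compares the bidder with itself,
      which reflexivity of the tie order settles.\<close>
    have W: "?W \<subseteq> won_items I (a(i := g t)) i"
      using S top_bid_ge[of _ a] tie_refl[OF i]
      by (auto simp: won_items_def g intro: le_less_trans)
    have "(\<Sum>j\<in>S. ?win j t) = (\<Sum>j\<in>?W. l j)"
      using fS by (simp add: indicator_def sum.If_cases Int_def mult_if_delta if_distrib cong: if_cong)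
    \<comment> \<open>The additive function supporting \<open>S\<close> is a lower bound for the
      valuation on every subset of \<open>M\<close>, here on the items surely won.\<close>
    also have "\<dots> \<le> v i ?W" using S by (intro l) auto
    also have "\<dots> \<le> v i (won_items I (a(i := g t)) i)"
      by (rule val_mono[OF i W won_items_subset])
    finally have 1: "(\<Sum>j\<in>S. ?win j t) \<le> v i (won_items I (a(i := g t)) i)" .
    have "payment I (a(i := g t)) i = (\<Sum>j\<in>M. if j \<in> S then t * (c * l j) else 0)"
      unfolding payment_def g by (intro sum.cong) auto
    also have "\<dots> = (\<Sum>j\<in>S. t * (c * l j))"
      using S by (subst sum.inter_restrict[symmetric]) (auto simp: Int_absorb1)
    also have "\<dots> = t * (c * v i S)"
      by (simp add: l(3) sum_distrib_left)
    finally show ?thesis using 1 by (simp add: utility_def)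
  qed
  have iw: "integrable ?U (?win j)" for j
  proof (rule U.integrable_const_bound)
    show "?win j \<in> borel_measurable ?U"
      by (rule measurable_restrict_space1) measurable
    show "AE t in ?U. norm (?win j t) \<le> \<bar>l j\<bar>"
      by (auto simp: indicator_def)
  qed
  have it: "integrable ?U (\<lambda>t. t)"
  proof (rule U.integrable_const_bound)
    show "(\<lambda>t. t) \<in> borel_measurable ?U"
      by (rule measurable_restrict_space1) simp
    show "AE t in ?U. norm t \<le> 1"
      by (rule AE_I2) (simp add: space_restrict_space)
  qed
  \<comment> \<open>In expectation, each item of \<open>S\<close> contributes at least
    \<open>c * l j\<close> minus its highest bid; the payment takes away half of
    \<open>c * v i S\<close>, as \<open>t\<close> has mean 1/2.\<close>
  have "c * v i S / 2 - (\<Sum>j\<in>S. top_bid I a j)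
      = (\<Sum>j\<in>S. c * l j - top_bid I a j) - (c * v i S) / 2"
    by (simp add: l(3) sum_subtractf sum_distrib_left[symmetric])
  also have "\<dots> \<le> (\<Sum>j\<in>S. \<integral>t. ?win j t \<partial>?U) - (c * v i S) / 2"
    using S by (intro diff_right_mono sum_mono uniform_bid_win c l top_bid_nonneg a) auto
  also have "\<dots> = (\<integral>t. (\<Sum>j\<in>S. ?win j t) - t * (c * v i S) \<partial>?U)"
    using iw it integral_unit_interval_id
    by (subst Bochner_Integration.integral_diff)
      (auto intro!: Bochner_Integration.integrable_sum simp: Bochner_Integration.integral_sum)
  also have "\<dots> \<le> (\<integral>t. utility I (a(i := g t)) i \<partial>?U)"
    using low by (intro integral_mono int Bochner_Integration.integrable_diff
      Bochner_Integration.integrable_sum iw integrable_mult_left it) auto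
  finally show ?thesis .
qed

text \<open>The set drawn from \<open>q\<close> is independent of the profile drawn from
  \<open>A\<close>, so the expected highest bid on \<open>j\<close> counts with the probability that
  \<open>j\<close> is drawn. Uniform bids cost half the scaled value on average, and only this half
  has to fit the budget.\<close>

lemma equilibrium_utility_bound:
  fixes q :: "nat set pmf" and c :: real
  assumes i: "i \<in> bidders I" and q: "set_pmf q \<subseteq> Pow M" and c: "0 \<le> c" "c \<le> 1"
    and budget: "ennreal (c * measure_pmf.expectation q (v i) / 2) \<le> budget I i"
  shows "c * measure_pmf.expectation q (v i) / 2
      - (\<Sum>j\<in>M. measure_pmf.prob q {S. j \<in> S} * expectation (\<lambda>a. top_bid I a j))
    \<le> expectation (\<lambda>a. v i (won_items I a i)) - expectation (\<lambda>a. payment I a i)"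
proof -
  obtain l where l: "\<And>S j. j \<in> M \<Longrightarrow> 0 \<le> l S j"
    "\<And>S T. T \<subseteq> M \<Longrightarrow> (\<Sum>j\<in>T. l S j) \<le> v i T"
    "\<And>S. S \<subseteq> M \<Longrightarrow> v i S = (\<Sum>j\<in>S. l S j)"
    using xos_supports[OF i] by blast
  let ?U = "restrict_space lborel {0..1::real}"
  let ?S = "measure_pmf q \<Otimes>\<^sub>M ?U"
  \<comment> \<open>The upper end of the uniform range: the scaled supporting weight inside
    \<open>S\<close>, zero outside.\<close>
  define w where "w S j = (if j \<in> S then c * l S j else 0)" for S j
  define g where "g = (\<lambda>(S, t). \<lambda>j\<in>M. t * w S j)"
  interpret U: prob_space ?U by (rule prob_space_unit_interval)
  interpret Q: pair_prob_space "measure_pmf q" ?U ..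
  interpret P: pair_prob_space ?S A ..
  have w0: "0 \<le> w S j" if "j \<in> M" for S j using that l(1) c by (simp add: w_def)
  have wsum: "(\<Sum>j\<in>M. w S j) \<le> v i M" for S
  proof -
    have "w S j \<le> l S j" if "j \<in> M" for j
      using that l(1) c by (auto simp: w_def intro: mult_left_le_one_le)
    then have "(\<Sum>j\<in>M. w S j) \<le> (\<Sum>j\<in>M. l S j)" by (rule sum_mono)
    also have "\<dots> \<le> v i M" by (rule l(2)) simp
    finally show ?thesis .
  qed
  have wS: "(\<Sum>j\<in>M. w S j) = c * v i S" if "S \<subseteq> M" for S
  proof -
    have "(\<Sum>j\<in>M. w S j) = (\<Sum>j\<in>S. c * l S j)"
      unfolding w_def using that by (subst sum.inter_restrict[symmetric]) (auto simp: Int_absorb1)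
    then show ?thesis by (simp add: l(3)[OF that] sum_distrib_left)
  qed
  have g: "g \<in> ?S \<rightarrow>\<^sub>M action_space I"
    unfolding action_space_def g_def split_beta
  proof (rule measurable_restrict)
    fix j assume j: "j \<in> M"
    have [measurable]: "(\<lambda>S. w S j) \<in> borel_measurable (measure_pmf q)" by simp
    have [measurable]: "(\<lambda>t. t) \<in> borel_measurable ?U"
      by (rule measurable_restrict_space1) simp
    have [measurable]: "snd \<in> borel_measurable ?S"
      using measurable_compose[OF measurable_snd \<open>(\<lambda>t. t) \<in> borel_measurable ?U\<close>] by simp
    have "(\<lambda>z. snd z * w (fst z) j) \<in> borel_measurable ?S"
      by measurable
    then show "(\<lambda>z. snd z * w (fst z) j) \<in> ?S \<rightarrow>\<^sub>M restrict_space borel {0..}"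
      by (rule measurable_restrict_space2[rotated])
        (use w0[OF j] in \<open>auto simp: space_pair_measure space_restrict_space\<close>)
  qed
  have gsum: "(\<Sum>j\<in>M. g (S, t) j) = t * (\<Sum>j\<in>M. w S j)" for S t
    by (simp add: g_def sum_distrib_left)
  have C: "(\<Sum>j\<in>M. g z j) \<le> v i M" if "z \<in> space ?S" for z
  proof (cases z)
    case (Pair S t)
    with that have t: "0 \<le> t" "t \<le> 1" by (auto simp: space_pair_measure space_restrict_space)
    have "t * (\<Sum>j\<in>M. w S j) \<le> (\<Sum>j\<in>M. w S j)"
      using t by (intro mult_left_le_one_le sum_nonneg w0)
    with wsum[of S] show ?thesis by (simp add: Pair gsum)
  qed
  have gn: "0 \<le> (\<Sum>j\<in>M. g z j)" if "z \<in> space ?S" for z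
    using measurable_space[OF g that] by (intro sum_nonneg action_space_nonneg)
  note Sp = Q.prob_space_axioms
  have int: "integrable (?S \<Otimes>\<^sub>M A) (\<lambda>(s, a). utility I (a(i := g s)) i)"
    by (rule integrable_deviation_utility[OF i Sp g C])
  have ipay: "integrable ?S (\<lambda>z. \<Sum>j\<in>M. g z j)"
    by (rule Q.integrable_const_bound[where B = "v i M"])
      (use C gn g measurable_compose[OF g measurable_action_component] in
        \<open>auto intro!: AE_I2 borel_measurable_sum\<close>)
  have iv: "integrable (measure_pmf q) (v i)"
    by (rule measure_pmf.integrable_const_bound[where B = "v i M"])
      (use q in \<open>auto simp: AE_measure_pmf_iff val_nonneg[OF i] intro!: val_mono[OF i]\<close>)
  \<comment> \<open>Averaging over \<open>t\<close> gives a factor 1/2, and the weights at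
    \<open>S\<close> sum to \<open>c * v i S\<close>; the expected payment is exactly the quantity
    bounded in \<open>budget\<close>.\<close>
  have "(\<integral>z. (\<Sum>j\<in>M. g z j) \<partial>?S) = (\<integral>S. (\<integral>t. t * (\<Sum>j\<in>M. w S j) \<partial>?U) \<partial>q)"
    using Q.integral_fst'[OF ipay] by (simp add: gsum)
  also have "\<dots> = (\<integral>S. c * v i S / 2 \<partial>q)"
    using q wS by (intro integral_cong_AE)
      (auto simp: AE_measure_pmf_iff integral_unit_interval_id subset_iff)
  also have "\<dots> = c * measure_pmf.expectation q (v i) / 2" by simp
  finally have gint: "(\<integral>z. (\<Sum>j\<in>M. g z j) \<partial>?S) = c * measure_pmf.expectation q (v i) / 2" .
  have "(\<integral>\<^sup>+ z. ennreal (\<Sum>j\<in>M. g z j) \<partial>?S) = ennreal (\<integral>z. (\<Sum>j\<in>M. g z j) \<partial>?S)"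
    by (rule nn_integral_eq_integral[OF ipay]) (use gn in auto)
  with budget have bud: "(\<integral>\<^sup>+ z. ennreal (\<Sum>j\<in>M. g z j) \<partial>?S) \<le> budget I i"
    unfolding gint by simp
  have uA: "integrable A (\<lambda>a. utility I a i)"
    unfolding utility_def
    by (intro Bochner_Integration.integrable_diff integrable_won_value integrable_payment i)
  \<comment> \<open>The profile \<open>a\<close> is fixed first and the deviation's own randomness
    averaged out. The resulting bound \<open>?low\<close> is affine in the highest bids, so
    averaging over \<open>A\<close> afterwards only replaces them by their expectations.\<close>
  let ?u = "\<lambda>a z. utility I (a(i := g z)) i"
  let ?low = "\<lambda>a. c * measure_pmf.expectation q (v i) / 2
      - (\<Sum>j\<in>M. measure_pmf.prob q {S. j \<in> S} * top_bid I a j)"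
  have iS: "integrable ?S (?u a)" if "a \<in> space A" for a
  proof (rule Q.integrable_const_bound[where B = "v i M + v i M"])
    show "AE z in ?S. norm (?u a z) \<le> v i M + v i M"
    proof (rule AE_I2)
      fix z assume "z \<in> space ?S"
      then show "norm (?u a z) \<le> v i M + v i M"
        using C[of z] gn[of z] won_value_bounds[OF i, of "a(i := g z)"]
        by (simp add: utility_def payment_def abs_le_iff)
    qed
    have "(\<lambda>z. (z, a)) \<in> ?S \<rightarrow>\<^sub>M ?S \<Otimes>\<^sub>M A" using that by simp
    from measurable_compose[OF this borel_measurable_integrable[OF int]]
    show "?u a \<in> borel_measurable ?S" by simp
  qed
  have low: "?low a \<le> (\<integral>z. ?u a z \<partial>?S)" if a: "a \<in> space A" for a
  proof -
    have intq: "integrable q (\<lambda>S. \<integral>t. ?u a (S, t) \<partial>?U)"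
      using Q.integrable_fst'[OF iS[OF a]] .
    \<comment> \<open>Fubini gives integrability almost everywhere, which under a pmf means at every
      point of the support.\<close>
    have it: "integrable ?U (\<lambda>t. ?u a (S, t))" if "S \<in> set_pmf q" for S
      using Q.AE_integrable_fst'[OF iS[OF a]] that by (simp add: AE_measure_pmf_iff)
    have ind: "integrable q (\<lambda>S. indicator {S. j \<in> S} S * top_bid I a j)" for j
      by (intro integrable_mult_left measure_pmf.integrable_const_bound[where B = 1])
        (auto simp: indicator_def)
    have isum: "integrable q (\<lambda>S. \<Sum>j\<in>M. indicator {S. j \<in> S} S * top_bid I a j)"
      by (rule Bochner_Integration.integrable_sum) (rule ind)
    have icv: "integrable q (\<lambda>S. c * v i S / 2)"
      using iv by simp
    have "(\<integral>S. (\<Sum>j\<in>M. indicator {S. j \<in> S} S * top_bid I a j) \<partial>q)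
        = (\<Sum>j\<in>M. \<integral>S. indicator {S. j \<in> S} S * top_bid I a j \<partial>q)"
      by (rule Bochner_Integration.integral_sum) (rule ind)
    also have "\<dots> = (\<Sum>j\<in>M. measure_pmf.prob q {S. j \<in> S} * top_bid I a j)"
      by (intro sum.cong refl) (subst integral_mult_left_zero, simp)
    finally have "?low a
        = (\<integral>S. c * v i S / 2 - (\<Sum>j\<in>M. indicator {S. j \<in> S} S * top_bid I a j) \<partial>q)"
      using Bochner_Integration.integral_diff[OF icv isum] by simp
    also have "\<dots> \<le> (\<integral>S. (\<integral>t. ?u a (S, t) \<partial>?U) \<partial>q)"
    proof (rule integral_mono_AE)
      show "AE S in q. c * v i S / 2 - (\<Sum>j\<in>M. indicator {S. j \<in> S} S * top_bid I a j)
        \<le> (\<integral>t. ?u a (S, t) \<partial>?U)"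
      proof (subst AE_measure_pmf_iff, rule ballI)
        fix S assume S: "S \<in> set_pmf q"
        then have SM: "S \<subseteq> M" using q by auto
        have "(\<Sum>j\<in>M. indicator {S. j \<in> S} S * top_bid I a j) = (\<Sum>j\<in>S. top_bid I a j)"
          using SM by (simp add: indicator_def sum.If_cases if_distrib[of "\<lambda>x. x * _"]
              Int_absorb1 cong: if_cong)
        then show "c * v i S / 2 - (\<Sum>j\<in>M. indicator {S. j \<in> S} S * top_bid I a j)
          \<le> (\<integral>t. ?u a (S, t) \<partial>?U)"
          using uniform_deviation_utility[OF i SM a, of "l S" c "\<lambda>t. g (S, t)"] l SM c it[OF S]
          by (simp add: g_def w_def)
      qed
    qed (intro Bochner_Integration.integrable_diff icv isum intq)+
    also have "\<dots> = (\<integral>z. ?u a z \<partial>?S)"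
      using Q.integral_fst'[OF iS[OF a]] .
    finally show ?thesis .
  qed
  have "c * measure_pmf.expectation q (v i) / 2
      - (\<Sum>j\<in>M. measure_pmf.prob q {S. j \<in> S} * expectation (\<lambda>a. top_bid I a j))
    = expectation ?low"
    using integrable_top_bid
    by (subst Bochner_Integration.integral_diff)
      (auto intro!: Bochner_Integration.integrable_sum
        simp: Bochner_Integration.integral_sum prob_space)
  also have "\<dots> \<le> expectation (\<lambda>a. \<integral>z. ?u a z \<partial>?S)"
    using low P.integrable_snd[OF int] integrable_top_bid
    by (intro integral_mono) (auto intro!: Bochner_Integration.integrable_sum)
  also have "\<dots> = (\<integral>(s, a). utility I (a(i := g s)) i \<partial>(?S \<Otimes>\<^sub>M A))"
    using P.integral_snd[OF int] .
  also have "\<dots> \<le> expectation (\<lambda>a. utility I a i)"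
    using deviation_bound[OF i Sp g bud int] by (simp add: ext_expectation_integrable[OF uA])
  also have "\<dots> = expectation (\<lambda>a. v i (won_items I a i)) - expectation (\<lambda>a. payment I a i)"
    unfolding utility_def
    by (intro Bochner_Integration.integral_diff integrable_won_value integrable_payment i)
  finally show ?thesis .
qed

section \<open>Summing the equilibrium conditions\<close>

lemma allocation_prob_sum_le_1:
  assumes p: "set_pmf p \<subseteq> feasible_allocations I" and K: "K \<subseteq> bidders I"
  shows "(\<Sum>i\<in>K. measure_pmf.prob p {x. j \<in> x i}) \<le> 1"
proof -
  have "finite K" by (rule finite_subset[OF K finite_bidders])
  \<comment> \<open>The events are known to be disjoint only within the support, where each
    allocation gives \<open>j\<close> to at most one bidder.\<close>
  have "(\<Sum>i\<in>K. measure_pmf.prob p {x. j \<in> x i})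
      = (\<Sum>i\<in>K. measure_pmf.prob p ({x. j \<in> x i} \<inter> set_pmf p))"
    by (simp add: measure_Int_set_pmf)
  also have "\<dots> = measure_pmf.prob p (\<Union>i\<in>K. {x. j \<in> x i} \<inter> set_pmf p)"
  proof (rule measure_pmf.finite_measure_finite_Union[symmetric])
    have "x i \<inter> x k = {}" if "x \<in> set_pmf p" "i \<in> K" "k \<in> K" "i \<noteq> k" for x i k
    proof -
      have "disjoint_family_on x (bidders I)"
        using p that(1) by (auto simp: feasible_allocations_def)
      with that K show ?thesis by (auto dest: disjoint_family_onD)
    qed
    then show "disjoint_family_on (\<lambda>i. {x. j \<in> x i} \<inter> set_pmf p) K"
      unfolding disjoint_family_on_def by blast
  qed (use \<open>finite K\<close> in auto)
  also have "\<dots> \<le> 1" by simp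
  finally show ?thesis .
qed

lemma liquid_welfare_of_lottery_le:
  assumes p: "set_pmf p \<subseteq> feasible_allocations I"
  shows "(\<Sum>i\<in>bidders I. min (\<integral>\<^sup>+ x. ennreal (v i (x i)) \<partial>measure_pmf p) (budget I i))
    \<le> 3 * liquid_welfare I A"
proof -
  let ?N = "bidders I"
  define W where "W i = expectation (\<lambda>a. v i (won_items I a i))" for i
  define P where "P i = expectation (\<lambda>a. payment I a i)" for i
  define \<beta> where "\<beta> j = expectation (\<lambda>a. top_bid I a j)" for j
  define V where "V i = measure_pmf.expectation p (\<lambda>x. v i (x i))" for i
  define opt where "opt i = enn2real (min (ennreal (V i)) (budget I i))" for i
  define lw where "lw i = enn2real (min (ennreal (W i)) (budget I i))" for i
  have fea: "x i \<subseteq> M" if "x \<in> set_pmf p" "i \<in> ?N" for x i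
    using that p by (fastforce simp: feasible_allocations_def)
  have V: "(\<integral>\<^sup>+ x. ennreal (v i (x i)) \<partial>measure_pmf p) = ennreal (V i)" "0 \<le> V i"
    if i: "i \<in> ?N" for i
  proof -
    have "integrable p (\<lambda>x. v i (x i))"
      by (rule measure_pmf.integrable_const_bound[where B = "v i M"])
        (use fea i in \<open>auto simp: AE_measure_pmf_iff val_nonneg intro!: val_mono\<close>)
    then show "(\<integral>\<^sup>+ x. ennreal (v i (x i)) \<partial>measure_pmf p) = ennreal (V i)"
      unfolding V_def
      by (rule nn_integral_eq_integral) (use fea i in \<open>auto simp: AE_measure_pmf_iff val_nonneg\<close>)
    show "0 \<le> V i"
      unfolding V_def
      by (rule integral_nonneg_AE) (use fea i in \<open>auto simp: AE_measure_pmf_iff val_nonneg\<close>)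
  qed
  have W: "(\<integral>\<^sup>+ a. ennreal (v i (won_items I a i)) \<partial>A) = ennreal (W i)" "0 \<le> W i"
    if i: "i \<in> ?N" for i
    unfolding W_def
    by (rule nn_integral_eq_integral[OF integrable_won_value[OF i]])
      (auto simp: won_value_bounds[OF i])
  have P: "ennreal (P i) \<le> budget I i" "0 \<le> P i" if i: "i \<in> ?N" for i
  proof -
    have "(\<integral>\<^sup>+ a. ennreal (payment I a i) \<partial>A) = ennreal (P i)"
      unfolding P_def
      by (rule nn_integral_eq_integral[OF integrable_payment[OF i]])
        (auto simp: payment_nonneg i space_A)
    moreover have "(\<integral>\<^sup>+ a. ennreal (payment I a i) \<partial>A) \<le> budget I i"
      using equil i unfolding coarse_correlated_equilibrium_def by blast
    ultimately show "ennreal (P i) \<le> budget I i" by simp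
    show "0 \<le> P i"
      unfolding P_def by (rule integral_nonneg_AE) (auto simp: payment_nonneg i space_A)
  qed
  \<comment> \<open>\<open>V i\<close> is real, so the minimum is finite even for an infinite
    budget.\<close>
  have opt: "min (ennreal (V i)) (budget I i) = ennreal (opt i)" for i
    unfolding opt_def by (rule ennreal_enn2real[symmetric]) (simp add: min_less_iff_disj)
  have lw: "min (ennreal (W i)) (budget I i) = ennreal (lw i)" for i
    unfolding lw_def by (rule ennreal_enn2real[symmetric]) (simp add: min_less_iff_disj)
  have opt0: "0 \<le> opt i" and lw0: "0 \<le> lw i" for i
    by (auto simp: opt_def lw_def)
  have optV: "opt i \<le> V i" if "i \<in> ?N" for i
    using opt[of i] V(2)[OF that] by (metis ennreal_le_iff min.cobounded1)
  have \<beta>0: "0 \<le> \<beta> j" if "j \<in> M" for j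
    unfolding \<beta>_def by (rule integral_nonneg_AE) (auto intro!: top_bid_nonneg that)
  have \<beta>P: "(\<Sum>j\<in>M. \<beta> j) \<le> (\<Sum>i\<in>?N. P i)"
  proof -
    have "(\<Sum>j\<in>M. \<beta> j) = expectation (\<lambda>a. \<Sum>j\<in>M. top_bid I a j)"
      unfolding \<beta>_def
      by (rule Bochner_Integration.integral_sum[symmetric]) (rule integrable_top_bid)
    also have "\<dots> \<le> expectation (\<lambda>a. \<Sum>i\<in>?N. payment I a i)"
      by (intro integral_mono Bochner_Integration.integrable_sum integrable_top_bid
          integrable_payment sum_top_bid_le)
    also have "\<dots> = (\<Sum>i\<in>?N. P i)"
      unfolding P_def by (rule Bochner_Integration.integral_sum) (rule integrable_payment)
    finally show ?thesis .
  qed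
  have key: "opt i / 2 - (\<Sum>j\<in>M. measure_pmf.prob p {x. j \<in> x i} * \<beta> j) \<le> W i - P i"
    if i: "i \<in> ?N" for i
  proof -
    \<comment> \<open>The factor scales the expected value to \<open>opt i\<close>. If
      \<open>V i = 0\<close>, then \<open>opt i = 0\<close> too, and any factor in the unit interval
      would do.\<close>
    define c where "c = (if V i = 0 then 1 else opt i / V i)"
    have c: "0 \<le> c" "c \<le> 1" "c * V i = opt i"
      using optV[OF i] opt0[of i] V(2)[OF i] by (auto simp: c_def divide_le_eq)
    let ?q = "map_pmf (\<lambda>x. x i) p"
    have "ennreal (opt i / 2) \<le> ennreal (opt i)"
      using opt0[of i] by (intro ennreal_leI) simp
    also have "\<dots> \<le> budget I i" unfolding opt[symmetric] by simp
    finally have "ennreal (c * measure_pmf.expectation ?q (v i) / 2) \<le> budget I i"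
      using c by (simp add: V_def)
    then show ?thesis
      using equilibrium_utility_bound[OF i, of ?q c] c fea i
      by (simp add: V_def W_def P_def \<beta>_def image_subset_iff vimage_def)
  qed
  \<comment> \<open>For bidders in \<open>K\<close>, the liquid welfare is the full expected value,
    from which payments can be subtracted. For all others it is the budget, which caps both their
    share of the optimum and their payment.\<close>
  define K where "K = {i \<in> ?N. ennreal (W i) < budget I i}"
  have K: "K \<subseteq> ?N" by (auto simp: K_def)
  have lwK: "lw i = W i" if "i \<in> K" for i
    using that W(2) by (simp add: lw_def K_def min_absorb1 less_imp_le)
  have sat: "opt i \<le> lw i" "P i \<le> lw i" if "i \<in> ?N - K" for i
  proof -
    have lwB: "ennreal (lw i) = budget I i"
      using that unfolding lw[symmetric] by (auto simp: K_def min_def)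
    have "ennreal (opt i) \<le> budget I i" unfolding opt[symmetric] by simp
    with lwB show "opt i \<le> lw i" using lw0 by (metis ennreal_le_iff)
    from P(1)[of i] that lwB show "P i \<le> lw i" using lw0 by (metis DiffD1 ennreal_le_iff)
  qed
  have split: "sum f ?N = sum f K + sum f (?N - K)" for f :: "nat \<Rightarrow> real"
    using sum.subset_diff[OF K, of f] by simp
  \<comment> \<open>Each highest bid is charged fractionally, with total weight at most 1 over the
    bidders of \<open>K\<close>, because allocations are disjoint.\<close>
  have "(\<Sum>i\<in>K. opt i / 2) - (\<Sum>j\<in>M. \<beta> j) \<le> (\<Sum>i\<in>K. W i - P i)"
  proof -
    have "(\<Sum>i\<in>K. \<Sum>j\<in>M. measure_pmf.prob p {x. j \<in> x i} * \<beta> j)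
        = (\<Sum>j\<in>M. (\<Sum>i\<in>K. measure_pmf.prob p {x. j \<in> x i}) * \<beta> j)"
      by (subst sum.swap) (simp add: sum_distrib_right)
    also have "\<dots> \<le> (\<Sum>j\<in>M. \<beta> j)"
      using allocation_prob_sum_le_1[OF p K] \<beta>0
      by (intro sum_mono mult_left_le_one_le) (auto intro: sum_nonneg)
    finally have "(\<Sum>i\<in>K. opt i / 2) - (\<Sum>j\<in>M. \<beta> j)
        \<le> (\<Sum>i\<in>K. opt i / 2 - (\<Sum>j\<in>M. measure_pmf.prob p {x. j \<in> x i} * \<beta> j))"
      by (simp add: sum_subtractf)
    also have "\<dots> \<le> (\<Sum>i\<in>K. W i - P i)"
      using K key by (intro sum_mono) auto
    finally show ?thesis .
  qed
  moreover have "(\<Sum>i\<in>K. W i) = (\<Sum>i\<in>K. lw i)"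
    using lwK by simp
  moreover have "(\<Sum>i\<in>?N - K. P i) \<le> (\<Sum>i\<in>?N - K. lw i)"
    "(\<Sum>i\<in>?N - K. opt i) \<le> (\<Sum>i\<in>?N - K. lw i)"
    by (intro sum_mono sat; simp)+
  moreover have "0 \<le> (\<Sum>i\<in>K. lw i)"
    by (intro sum_nonneg lw0)
  \<comment> \<open>By \<open>\<beta>P\<close>, the payments within \<open>K\<close> cancel and
    those outside are at most \<open>lw\<close>, so \<open>opt\<close> sums over \<open>K\<close> to
    at most twice the whole liquid welfare. Outside \<open>K\<close> it adds at most
    \<open>lw\<close> once more: weight 2 on \<open>K\<close> and 3 elsewhere.\<close>
  ultimately have main: "(\<Sum>i\<in>?N. opt i) \<le> 3 * (\<Sum>i\<in>?N. lw i)"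
    using \<beta>P by (simp add: split sum_subtractf sum_divide_distrib[symmetric])
  have "(\<Sum>i\<in>?N. min (\<integral>\<^sup>+ x. ennreal (v i (x i)) \<partial>measure_pmf p) (budget I i))
      = ennreal (\<Sum>i\<in>?N. opt i)"
    using opt0 by (simp add: V opt)
  also have "\<dots> \<le> ennreal (3 * (\<Sum>i\<in>?N. lw i))"
    by (rule ennreal_leI[OF main])
  also have "\<dots> = 3 * liquid_welfare I A"
    using lw0 by (simp add: liquid_welfare_def W lw ennreal_mult sum_nonneg)
  finally show ?thesis .
qed

lemma optimal_liquid_welfare_le: "optimal_liquid_welfare I \<le> 3 * liquid_welfare I A"
  unfolding optimal_liquid_welfare_def
  by (rule SUP_least) (auto intro: liquid_welfare_of_lottery_le)

end

theorem theorem4p7: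
  "price_of_anarchy xos_instance \<le> 3 \<and>
   (\<forall>I A. xos_instance I \<and> coarse_correlated_equilibrium I A \<longrightarrow>
      optimal_liquid_welfare I \<le> 3 * liquid_welfare I A)"
proof -
  have bound: "optimal_liquid_welfare I \<le> 3 * liquid_welfare I A"
    if "xos_instance I" "coarse_correlated_equilibrium I A" for I A
    using xos_equilibrium.optimal_liquid_welfare_le[OF xos_equilibrium.intro[OF that]] .
  have ratio: "x / y \<le> 3" if "x \<le> 3 * y" for x y :: ennreal
  \<comment> \<open>If \<open>y = 0\<close> then \<open>x = 0\<close>, and 0 / 0 is 0 in
    \<open>ennreal\<close>; division by \<open>\<top>\<close> gives 0 as well, even for
    \<open>x = \<top>\<close>.\<close>
  proof (cases "y = 0 \<or> y = \<top>")
    case True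
    then show ?thesis using that by auto
  next
    case False
    have "x / y \<le> 3 * y / y" using that by (rule divide_right_mono_ennreal)
    also have "\<dots> = 3" using False by (simp add: ennreal_mult_divide_eq)
    finally show ?thesis .
  qed
  have "price_of_anarchy xos_instance \<le> 3"
    unfolding price_of_anarchy_def by (rule SUP_least) (auto intro: ratio bound)
  with bound show ?thesis by blast
qed

end
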